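(* Let $n\le m$ be positive integers. Then \[\min\left\{\frac{n-3}{2},\ \frac{2m+n-10}{8}\right\}\le \rho(P_n\Box P_m)\le \frac{n}{2}.\]
   Context: $P_n\Box P_m$ denotes the Cartesian product of paths on $n$ and $m$ vertices (the $n\times m$ grid). Patrol game with radius of capture $\rho\ge 0$ on a connected graph $G$: there is one cop and one robber. Before the game the cop fixes a walk in $G$ (his patrol: a sequence of vertices in which consecutive vertices are equal or adjacent), and the robber knows the entire patrol in advance, while the cop has no information about the robber. The cop starts at the first vertex of his patrol, then the robber chooses a starting vertex; afterwards the players alternate moves (cop first), the cop following his patrol and the robber moving to an adjacent vertex or staying put. The cop wins if at some moment the distance between the cop and the robber is at most $\rho$; otherwise the robber wins. $\rho(G)$ is the minimum $\rho\ge0$ for which the cop has a patrol capturing the robber regardless of the robber's play. *)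

theory Defs
  imports Complex_Main "Graph_Theory.Graph_Theory"
begin

text \<open>Undirected graphs are symmetric digraphs, as in \<^locale>\<open>graph\<close> and \<^locale>\<open>pair_graph\<close>.\<close>

definition path_graph :: "nat \<Rightarrow> nat pair_pre_digraph" where
  "path_graph n = \<lparr> pverts = {1..n},
     parcs = {(i, j). i \<in> {1..n} \<and> j \<in> {1..n} \<and> (j = Suc i \<or> i = Suc j)} \<rparr>"

definition cart_prod ::
    "'a pair_pre_digraph \<Rightarrow> 'b pair_pre_digraph \<Rightarrow> ('a \<times> 'b) pair_pre_digraph"
    (infixr \<open>\<box>\<close> 75) where
  "G \<box> H = \<lparr> pverts = pverts G \<times> pverts H,
     parcs = {((u, x), (v, y)). (u = v \<and> u \<in> pverts G \<and> (x, y) \<in> parcs H)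
                              \<or> (x = y \<and> x \<in> pverts H \<and> (u, v) \<in> parcs G)} \<rparr>"

lemma pair_graph_path_graph: "pair_graph (path_graph n)"
  by unfold_locales
    (auto simp: path_graph_def symmetric_def sym_def
          intro: finite_subset[of _ "{1..n} \<times> {1..n}"])

lemma pair_graph_cart_prod:
  assumes "pair_graph G" "pair_graph H"
  shows "pair_graph (G \<box> H)"
proof -
  interpret G: pair_graph G by fact
  interpret H: pair_graph H by fact
  have wf: "parcs (G \<box> H) \<subseteq> pverts (G \<box> H) \<times> pverts (G \<box> H)"
    by (auto simp: cart_prod_def dest: G.in_arcsD1 G.in_arcsD2 H.in_arcsD1 H.in_arcsD2)
  have fin: "finite (pverts (G \<box> H))"
    by (simp add: cart_prod_def)
  have symm: "sym (parcs (G \<box> H))"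
    using G.sym_arcs H.sym_arcs by (auto simp: cart_prod_def symmetric_def sym_def)
  show ?thesis
  proof unfold_locales
    show "fst e \<in> pverts (G \<box> H)" if "e \<in> parcs (G \<box> H)" for e
      using wf that by auto
    show "snd e \<in> pverts (G \<box> H)" if "e \<in> parcs (G \<box> H)" for e
      using wf that by auto
    show "finite (pverts (G \<box> H))" by fact
    show "finite (parcs (G \<box> H))"
      using fin wf by (meson finite_SigmaI finite_subset)
    show "fst e \<noteq> snd e" if "e \<in> parcs (G \<box> H)" for e
      using that G.no_loops H.no_loops by (auto simp: cart_prod_def)
    show "symmetric (with_proj (G \<box> H))"
      using symm by (simp add: symmetric_def)
  qed
qed

text \<open>The shortest-path function \<open>\<mu>\<close> with unit weights; \<open>\<infinity>\<close> if there is no walk.\<close>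

definition gdist :: "('a, 'b) pre_digraph \<Rightarrow> 'a \<Rightarrow> 'a \<Rightarrow> ereal" where
  "gdist G u v = wf_digraph.\<mu> G (\<lambda>_. 1) u v"

definition lazy_walk :: "('a, 'b) pre_digraph \<Rightarrow> (nat \<Rightarrow> 'a) \<Rightarrow> bool" where
  "lazy_walk G w \<longleftrightarrow>
     (\<forall>t. w t \<in> verts G \<and> (w (Suc t) = w t \<or> w t \<rightarrow>\<^bsub>G\<^esub> w (Suc t)))"

text \<open>
  The play visits the positions
  \<open>(c 0, r 0), (c 1, r 0), (c 1, r 1), (c 2, r 1), \<dots>\<close>
  of cop and robber, since the cop moves first in every round.
\<close>

definition captures ::
    "('a, 'b) pre_digraph \<Rightarrow> nat \<Rightarrow> (nat \<Rightarrow> 'a) \<Rightarrow> (nat \<Rightarrow> 'a) \<Rightarrow> bool" where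
  "captures G \<rho> c r \<longleftrightarrow>
     (\<exists>t. gdist G (c t) (r t) \<le> ereal (real \<rho>) \<or> gdist G (c (Suc t)) (r t) \<le> ereal (real \<rho>))"

text \<open>
  As the patrol \<open>c\<close> is known to the robber in advance, a robber strategy against \<open>c\<close>
  is just a walk \<open>r\<close>. A finite patrol is an eventually constant one.
\<close>

definition winning_patrol :: "('a, 'b) pre_digraph \<Rightarrow> nat \<Rightarrow> (nat \<Rightarrow> 'a) \<Rightarrow> bool" where
  "winning_patrol G \<rho> c \<longleftrightarrow> lazy_walk G c \<and> (\<forall>r. lazy_walk G r \<longrightarrow> captures G \<rho> c r)"

text \<open>Distances are integers, so only integral radii matter for the minimum.\<close>

definition patrol_radius :: "('a, 'b) pre_digraph \<Rightarrow> nat" where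
  "patrol_radius G = (LEAST \<rho>. \<exists>c. winning_patrol G \<rho> c)"

end

theory Submission
  imports Defs
begin

text \<open>
  Upper bound: patrolling a middle row, the cop always watches his whole column.

  Lower bound: let \<open>h = \<rho> + 2\<close> and suppose \<open>2 * h \<le> n\<close>. The robber stays in a
  \<open>2h \<times> 2h\<close> corner of the grid, at distance exactly \<open>h\<close> from the cop's projection to that corner;
  the one unit to spare pays for the cop's moving first. Call a vertex at distance \<open>h\<close> from the
  projected cop clean if no robber of this kind can be there. The number of clean vertices never
  exceeds the distance from the projected cop to the nearest corner of the square, which is less
  than the number of all vertices at distance \<open>h\<close>. So some robber survives every finite time, and
  by compactness one survives forever.
\<close>

section \<open>Clean vertices around the cop\<close>

definition l1_dist :: "int \<times> int \<Rightarrow> int \<times> int \<Rightarrow> int" where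
  "l1_dist p q = \<bar>fst p - fst q\<bar> + \<bar>snd p - snd q\<bar>"

definition box :: "int \<Rightarrow> (int \<times> int) set" where
  "box h = {0..2 * h - 1} \<times> {0..2 * h - 1}"

definition shell :: "int \<Rightarrow> int \<times> int \<Rightarrow> (int \<times> int) set" where
  "shell h c = {r \<in> box h. l1_dist c r = h}"

text \<open>If the robber may be anywhere in \<open>D\<close>, these are the positions open to him
  once the projected cop has moved to \<open>c\<close> and he has answered by a move onto the new
  shell.\<close>

definition spread :: "int \<Rightarrow> int \<times> int \<Rightarrow> (int \<times> int) set \<Rightarrow> (int \<times> int) set" where
  "spread h c D = {r \<in> shell h c. \<exists>q\<in>D. l1_dist q r \<le> 1}"

definition corner_dist :: "int \<Rightarrow> int \<times> int \<Rightarrow> int" where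
  "corner_dist h c = min (fst c) (2 * h - 1 - fst c) + min (snd c) (2 * h - 1 - snd c)"

text \<open>The invariant of the lower bound: \<open>D\<close> is the set of positions still
  possible for the robber, so the clean vertices are those of \<open>shell h c - D\<close>.\<close>

definition few_clean :: "int \<Rightarrow> int \<times> int \<Rightarrow> (int \<times> int) set \<Rightarrow> bool" where
  "few_clean h c D \<longleftrightarrow> int (card (shell h c - D)) \<le> corner_dist h c"

text \<open>
  For a cop at \<open>(a, b)\<close> with \<open>b < h\<close>, the shell has in each row \<open>x\<close> at most one vertex in a
  column \<open>\<ge> b\<close> and at most one in a column \<open>< b\<close>. Indexed by \<open>x\<close>, a vertex of the shell after a vertical move of
  the cop is adjacent or equal to the vertices of the old shell with index \<open>x\<close> (the robber moves
  within the row) and \<open>x + a - a'\<close> (he moves along with the cop), where \<open>a'\<close> is the new row of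
  the cop.
\<close>

definition right_clean :: "int \<Rightarrow> int \<Rightarrow> int \<Rightarrow> (int \<times> int) set \<Rightarrow> int set" where
  "right_clean h a b D = {x \<in> {0..2 * h - 1}. \<bar>x - a\<bar> \<le> h \<and> (x, b + h - \<bar>x - a\<bar>) \<notin> D}"

text \<open>\<open>h - b \<le> a - x\<close> keeps the column nonnegative; the strict
  \<open>a - x < h\<close> leaves the vertex in column \<open>b\<close> to
  \<open>right_clean\<close>.\<close>

definition upper_clean :: "int \<Rightarrow> int \<Rightarrow> int \<Rightarrow> (int \<times> int) set \<Rightarrow> int set" where
  "upper_clean h a b D = {x \<in> {0..2 * h - 1}. h - b \<le> a - x \<and> a - x < h \<and> (x, b - h + (a - x)) \<notin> D}"

definition lower_clean :: "int \<Rightarrow> int \<Rightarrow> int \<Rightarrow> (int \<times> int) set \<Rightarrow> int set" where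
  "lower_clean h a b D = {x \<in> {0..2 * h - 1}. h - b \<le> x - a \<and> x - a < h \<and> (x, b - h + (x - a)) \<notin> D}"

lemmas clean_defs = right_clean_def upper_clean_def lower_clean_def

lemma finite_box [simp]: "finite (box h)"
  by (simp add: box_def)

lemma finite_shell [simp]: "finite (shell h c)"
  by (simp add: shell_def)

lemma finite_clean [simp]:
  "finite (right_clean h a b D)" "finite (upper_clean h a b D)" "finite (lower_clean h a b D)"
  by (auto simp: clean_defs intro: finite_subset[of _ "{0..2 * h - 1}"])

text \<open>Each arc is the graph of a function of the row, so vertices and indices are
  equinumerous. \<open>b < h\<close> keeps the right arc within columns up to
  \<open>2 * h - 1\<close> and makes \<open>h - b\<close> positive, so row \<open>a\<close> lies in
  neither left arc.\<close>

lemma card_clean: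
  assumes "0 \<le> b" "b < h"
  shows "card (shell h (a, b) - D) =
    card (right_clean h a b D) + card (upper_clean h a b D) + card (lower_clean h a b D)"
proof -
  let ?R = "(\<lambda>x. (x, b + h - \<bar>x - a\<bar>)) ` right_clean h a b D"
  let ?U = "(\<lambda>x. (x, b - h + (a - x))) ` upper_clean h a b D"
  let ?L = "(\<lambda>x. (x, b - h + (x - a))) ` lower_clean h a b D"
  have eq: "shell h (a, b) - D = ?R \<union> ?U \<union> ?L"
  proof (intro equalityI subsetI)
    fix r assume r: "r \<in> shell h (a, b) - D"
    obtain x y where [simp]: "r = (x, y)" by force
    have xy: "x \<in> {0..2*h-1}" "0 \<le> y" "\<bar>a - x\<bar> + \<bar>b - y\<bar> = h" "(x, y) \<notin> D"
      using r by (auto simp: shell_def box_def l1_dist_def)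
    consider "y \<ge> b" | "y < b" "x < a" | "y < b" "x \<ge> a" by linarith
    then show "r \<in> ?R \<union> ?U \<union> ?L"
    proof cases
      case 1
      then have "y = b + h - \<bar>x - a\<bar>" using xy by linarith
      moreover have "x \<in> right_clean h a b D"
        using xy 1 calculation by (auto simp: right_clean_def)
      ultimately show ?thesis by auto
    next
      case 2
      then have "y = b - h + (a - x)" using xy by linarith
      moreover have "x \<in> upper_clean h a b D"
        using xy 2 calculation by (auto simp: upper_clean_def)
      ultimately show ?thesis by auto
    next
      case 3
      then have "y = b - h + (x - a)" using xy by linarith
      moreover have "x \<in> lower_clean h a b D"
        using xy 3 calculation by (auto simp: lower_clean_def)
      ultimately show ?thesis by auto
    qed
  next
    fix r assume "r \<in> ?R \<union> ?U \<union> ?L"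
    then show "r \<in> shell h (a, b) - D"
      using assms by (auto simp: clean_defs shell_def box_def l1_dist_def)
  qed
  have disj: "?R \<inter> ?U = {}" "(?R \<union> ?U) \<inter> ?L = {}"
    using assms by (auto simp: clean_defs)
  have "card (shell h (a, b) - D) = card ?R + card ?U + card ?L"
    unfolding eq using disj by (simp add: card_Un_disjoint)
  also have "card ?R = card (right_clean h a b D)"
    by (rule card_image) (auto simp: inj_on_def)
  also have "card ?U = card (upper_clean h a b D)"
    by (rule card_image) (auto simp: inj_on_def)
  also have "card ?L = card (lower_clean h a b D)"
    by (rule card_image) (auto simp: inj_on_def)
  finally show ?thesis .
qed

section \<open>Clean vertices after one vertical move of the cop\<close>

lemma not_in_spread:
  assumes "r \<notin> spread h c D" "r \<in> shell h c" "l1_dist q r \<le> 1"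
  shows "q \<notin> D"
  using assms by (auto simp: spread_def)

text \<open>A new vertex is clean only if all its predecessors on the old shell were. For
  \<open>z = x\<close> the column changes by one, for the other choice only the row does, so
  \<open>z\<close> indexes a predecessor; its bounds place it on the old shell.\<close>

lemma right_clean_spread:
  assumes "0 \<le> b" "b < h" "x \<in> right_clean h a' b (spread h (a', b) D)" "\<bar>a - a'\<bar> = 1"
    and "z \<in> {0..2 * h - 1}" "\<bar>z - a\<bar> \<le> h" "z = x \<or> z = x + (a - a')"
  shows "z \<in> right_clean h a b D"
proof -
  have "(z, b + h - \<bar>z - a\<bar>) \<notin> D"
    by (rule not_in_spread[of "(x, b + h - \<bar>x - a'\<bar>)" h "(a', b)"])
      (use assms in \<open>auto simp: right_clean_def shell_def box_def l1_dist_def\<close>)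
  then show ?thesis using assms by (auto simp: right_clean_def)
qed

lemma upper_clean_spread:
  assumes "0 \<le> b" "b < h" "x \<in> upper_clean h a' b (spread h (a', b) D)" "\<bar>a - a'\<bar> = 1"
    and "z \<in> {0..2 * h - 1}" "h - b \<le> a - z" "a - z < h" "z = x \<or> z = x + (a - a')"
  shows "z \<in> upper_clean h a b D"
proof -
  have "(z, b - h + (a - z)) \<notin> D"
    by (rule not_in_spread[of "(x, b - h + (a' - x))" h "(a', b)"])
      (use assms in \<open>auto simp: upper_clean_def shell_def box_def l1_dist_def\<close>)
  then show ?thesis using assms by (auto simp: upper_clean_def)
qed

lemma lower_clean_spread:
  assumes "0 \<le> b" "b < h" "x \<in> lower_clean h a' b (spread h (a', b) D)" "\<bar>a - a'\<bar> = 1"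
    and "z \<in> {0..2 * h - 1}" "h - b \<le> z - a" "z - a < h" "z = x \<or> z = x + (a - a')"
  shows "z \<in> lower_clean h a b D"
proof -
  have "(z, b - h + (z - a)) \<notin> D"
    by (rule not_in_spread[of "(x, b - h + (x - a'))" h "(a', b)"])
      (use assms in \<open>auto simp: lower_clean_def shell_def box_def l1_dist_def\<close>)
  then show ?thesis using assms by (auto simp: lower_clean_def)
qed

lemma card_shift_le:
  fixes A B :: "int set"
  assumes "finite B" "\<And>x. x \<in> A \<Longrightarrow> x + d \<in> B"
  shows "card A \<le> card B"
  by (rule card_inj_on_le[of "\<lambda>x. x + d"]) (use assms in \<open>auto simp: inj_on_def\<close>)

text \<open>\<open>A\<close> lies in \<open>B\<close> and misses \<open>Max B\<close>, whose
  successor is not in \<open>B\<close>. If \<open>B\<close> is empty, so is \<open>A\<close>, and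
  the truncated subtraction does no harm.\<close>

lemma card_drop_Max:
  fixes A B :: "int set"
  assumes "finite B" "\<And>x. x \<in> A \<Longrightarrow> x \<in> B \<and> x + 1 \<in> B"
  shows "card A \<le> card B - 1"
proof (cases "B = {}")
  case False
  have "A \<subseteq> B - {Max B}"
    using assms Max_ge[OF assms(1)] by fastforce
  then have "card A \<le> card (B - {Max B})"
    using assms(1) by (intro card_mono) auto
  then show ?thesis using False assms(1) by simp
next
  case True
  then have "A = {}" using assms(2) by auto
  then show ?thesis by simp
qed

text \<open>The cop approaches the corner, so the bound drops by one. The right and upper arcs each
  lose a clean vertex unless they have none; if both have none, only the lower arc counts, with at
  most \<open>b \<le> a - 1 + b\<close> vertices.\<close>

lemma few_clean_up:
  assumes b: "0 \<le> b" "b < h" and a: "1 \<le> a" "a < h" and D: "few_clean h (a, b) D"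
  shows "few_clean h (a - 1, b) (spread h (a - 1, b) D)"
proof -
  let ?E = "spread h (a - 1, b) D"
  let ?R = "right_clean h a b D" and ?U = "upper_clean h a b D" and ?L = "lower_clean h a b D"
  let ?R' = "right_clean h (a - 1) b ?E" and ?U' = "upper_clean h (a - 1) b ?E"
    and ?L' = "lower_clean h (a - 1) b ?E"
  have "card ?R' \<le> card ?R - 1"
  proof (rule card_drop_Max)
    fix x assume x: "x \<in> ?R'"
    then have "0 \<le> x" "x \<le> a - 1 + h" by (auto simp: right_clean_def)
    then show "x \<in> ?R \<and> x + 1 \<in> ?R"
      using a b by (auto intro!: right_clean_spread[OF b x])
  qed simp
  moreover have "card ?U' \<le> card ?U - 1"
  proof (rule card_drop_Max)
    fix x assume x: "x \<in> ?U'"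
    then have "0 \<le> x" "h - b \<le> a - 1 - x" "a - 1 - x < h" by (auto simp: upper_clean_def)
    then show "x \<in> ?U \<and> x + 1 \<in> ?U"
      using a b by (auto intro!: upper_clean_spread[OF b x])
  qed simp
  moreover have "card ?L' \<le> card ?L"
  proof (rule card_shift_le)
    fix x assume x: "x \<in> ?L'"
    then have "0 \<le> x" "h - b \<le> x - (a - 1)" "x - (a - 1) < h" by (auto simp: lower_clean_def)
    then show "x + 1 \<in> ?L"
      using a b by (auto intro!: lower_clean_spread[OF b x])
  qed simp
  moreover have "card ?L \<le> nat b"
  proof -
    have "card ?L \<le> card {a + h - b..<a + h}"
      by (rule card_mono) (auto simp: lower_clean_def)
    then show ?thesis by simp
  qed
  moreover have "int (card ?R + card ?U + card ?L) \<le> a + b"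
    using D a b by (simp add: few_clean_def card_clean corner_dist_def)
  ultimately have "int (card ?R' + card ?U' + card ?L') \<le> a - 1 + b"
    using a b by linarith
  then show ?thesis using a b by (simp add: few_clean_def card_clean corner_dist_def)
qed

text \<open>The cop leaves the corner, so the bound grows by one. The upper arc uses up this gain,
  the lower arc just shifts, and the work is to show that the right arc gains nothing although it
  gets a new row.\<close>

lemma few_clean_down:
  assumes b: "0 \<le> b" "b < h" and a: "0 \<le> a" "a + 1 < h" and D: "few_clean h (a, b) D"
  shows "few_clean h (a + 1, b) (spread h (a + 1, b) D)"
proof -
  let ?E = "spread h (a + 1, b) D"
  let ?R = "right_clean h a b D" and ?U = "upper_clean h a b D" and ?L = "lower_clean h a b D"
  let ?R' = "right_clean h (a + 1) b ?E" and ?U' = "upper_clean h (a + 1) b ?E"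
    and ?L' = "lower_clean h (a + 1) b ?E"
  have sum: "int (card ?R + card ?U + card ?L) \<le> a + b"
    using D a b by (simp add: few_clean_def card_clean corner_dist_def)
  have R': "x \<in> ?R' \<Longrightarrow> 0 \<le> x \<and> x \<le> a + 1 + h \<and> (x \<le> a + h \<longrightarrow> x \<in> ?R) \<and> (x \<ge> 1 \<longrightarrow> x - 1 \<in> ?R)" for x
  proof -
    assume x: "x \<in> ?R'"
    then have "0 \<le> x" "x \<le> a + 1 + h" by (auto simp: right_clean_def)
    then show ?thesis
      using a b by (auto intro!: right_clean_spread[OF b x])
  qed
  \<comment> \<open>The right part has more than \<open>a + b\<close> vertices, so one of them is not clean; the last such one
    contaminates its successor, which makes up for the new row \<open>a + h + 1\<close>.\<close>
  have "card ?R' \<le> card ?R"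
  proof (cases "a + h \<in> ?R")
    case False
    \<comment> \<open>The new row \<open>a + h + 1\<close> could be clean only if row
      \<open>a + h\<close> had been.\<close>
    have "?R' \<subseteq> ?R"
    proof
      fix x assume "x \<in> ?R'"
      then show "x \<in> ?R" using R'[of x] False a b by (cases "x = a + h + 1") auto
    qed
    then show ?thesis by (intro card_mono) auto
  next
    case True
    have "\<not> {0..a + h} \<subseteq> ?R"
    proof
      assume "{0..a + h} \<subseteq> ?R"
      then have "card {0..a + h} \<le> card ?R" by (intro card_mono) auto
      then show False using sum a b by simp
    qed
    then have ne: "{0..a + h} - ?R \<noteq> {}" by auto
    define m where "m = Max ({0..a + h} - ?R)"
    have m: "m \<in> {0..a + h} - ?R" unfolding m_def by (rule Max_in) (use ne in auto)
    have m1: "m + 1 \<in> ?R"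
    proof (rule ccontr)
      assume n: "m + 1 \<notin> ?R"
      have "m \<noteq> a + h" using m True by auto
      then have "m + 1 \<in> {0..a + h} - ?R" using m n by auto
      then have "m + 1 \<le> m" unfolding m_def by (intro Max_ge) auto
      then show False by simp
    qed
    have "?R' \<subseteq> insert (a + h + 1) (?R - {m + 1})"
    proof
      fix x assume "x \<in> ?R'"
      moreover from this have "x \<noteq> m + 1" using R'[of "m + 1"] m by auto
      ultimately show "x \<in> insert (a + h + 1) (?R - {m + 1})" using R'[of x] by auto
    qed
    then have "card ?R' \<le> card (insert (a + h + 1) (?R - {m + 1}))"
      by (intro card_mono) auto
    also have "\<dots> \<le> Suc (card (?R - {m + 1}))" by (rule card_insert_le_m1) auto
    also have "\<dots> = card ?R" using m1 by (intro card_Suc_Diff1) auto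
    finally show ?thesis .
  qed
  moreover have "card ?U' \<le> card ?U + 1"
  proof -
    \<comment> \<open>The only new index is that of the vertex in column 0.\<close>
    have "?U' \<subseteq> insert (a + 1 - h + b) ?U"
    proof
      fix x assume x: "x \<in> ?U'"
      then have "0 \<le> x" "h - b \<le> a + 1 - x" "a + 1 - x < h" by (auto simp: upper_clean_def)
      then show "x \<in> insert (a + 1 - h + b) ?U"
        using a b by (cases "x = a + 1 - h + b") (auto intro!: upper_clean_spread[OF b x])
    qed
    then have "card ?U' \<le> card (insert (a + 1 - h + b) ?U)" by (intro card_mono) auto
    also have "\<dots> \<le> card ?U + 1" by (simp add: card_insert_if)
    finally show ?thesis .
  qed
  moreover have "card ?L' \<le> card ?L"
  proof (rule card_shift_le)
    fix x assume x: "x \<in> ?L'"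
    then have "0 \<le> x" "h - b \<le> x - (a + 1)" "x - (a + 1) < h" by (auto simp: lower_clean_def)
    then show "x + (-1) \<in> ?L"
      using a b by (auto intro!: lower_clean_spread[OF b x])
  qed simp
  ultimately have "int (card ?R' + card ?U' + card ?L') \<le> a + 1 + b"
    using sum by linarith
  then show ?thesis using a b by (simp add: few_clean_def card_clean corner_dist_def)
qed

text \<open>Rows \<open>h - 1\<close> and \<open>h\<close> are mirror images, so the bound stays the
  same and no gain is allowed. Both right arcs meet every row of the box, and the left arcs inject
  into the old ones by moving along with the cop.\<close>

lemma few_clean_cross:
  assumes b: "0 \<le> b" "b < h" and D: "few_clean h (h - 1, b) D"
  shows "few_clean h (h, b) (spread h (h, b) D)"
proof -
  let ?E = "spread h (h, b) D" and ?a = "h - 1"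
  let ?R = "right_clean h ?a b D" and ?U = "upper_clean h ?a b D" and ?L = "lower_clean h ?a b D"
  let ?R' = "right_clean h h b ?E" and ?U' = "upper_clean h h b ?E"
    and ?L' = "lower_clean h h b ?E"
  have "card ?R' \<le> card ?R"
  proof (rule card_mono)
    show "?R' \<subseteq> ?R"
    proof
      fix x assume x: "x \<in> ?R'"
      then have "0 \<le> x" "x \<le> 2 * h - 1" by (auto simp: right_clean_def)
      then show "x \<in> ?R"
        using b by (auto intro!: right_clean_spread[OF b x])
    qed
  qed simp
  moreover have "card ?U' \<le> card ?U"
  proof (rule card_shift_le)
    fix x assume x: "x \<in> ?U'"
    then have "0 \<le> x" "h - b \<le> h - x" "h - x < h" by (auto simp: upper_clean_def)
    then show "x + (-1) \<in> ?U"
      using b by (auto intro!: upper_clean_spread[OF b x])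
  qed simp
  moreover have "card ?L' \<le> card ?L"
  proof (rule card_shift_le)
    fix x assume x: "x \<in> ?L'"
    then have "0 \<le> x" "x \<le> 2 * h - 1" "h - b \<le> x - h" by (auto simp: lower_clean_def)
    then show "x + (-1) \<in> ?L"
      using b by (auto intro!: lower_clean_spread[OF b x])
  qed simp
  moreover have "int (card ?R + card ?U + card ?L) \<le> h - 1 + b"
    using D b by (simp add: few_clean_def card_clean corner_dist_def)
  ultimately show ?thesis using b by (simp add: few_clean_def card_clean corner_dist_def)
qed

section \<open>Reduction by the symmetries of the square\<close>

definition preserves_few_clean :: "int \<Rightarrow> int \<times> int \<Rightarrow> int \<times> int \<Rightarrow> bool" where
  "preserves_few_clean h c c' \<longleftrightarrow> (\<forall>D. few_clean h c D \<longrightarrow> few_clean h c' (spread h c' D))"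

text \<open>Taking only involutions avoids a separate inverse; the two axis reflections and the
  transposition are all that the reduction uses.\<close>

definition box_symmetry :: "int \<Rightarrow> (int \<times> int \<Rightarrow> int \<times> int) \<Rightarrow> bool" where
  "box_symmetry h f \<longleftrightarrow> (\<forall>p. f (f p) = p) \<and> (\<forall>p q. l1_dist (f p) (f q) = l1_dist p q)
     \<and> (\<forall>p. f p \<in> box h \<longleftrightarrow> p \<in> box h) \<and> (\<forall>p. corner_dist h (f p) = corner_dist h p)"

lemma box_symmetry_flips:
  "box_symmetry h (\<lambda>(x, y). (2 * h - 1 - x, y))"
  "box_symmetry h (\<lambda>(x, y). (x, 2 * h - 1 - y))"
  "box_symmetry h (\<lambda>(x, y). (y, x))"
  by (auto simp: box_symmetry_def l1_dist_def box_def corner_dist_def)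

context
  fixes h f assumes f: "box_symmetry h f"
begin

lemma involution: "f (f p) = p"
  and l1_symmetry: "l1_dist (f p) (f q) = l1_dist p q"
  and in_box_symmetry: "f p \<in> box h \<longleftrightarrow> p \<in> box h"
  and corner_dist_symmetry: "corner_dist h (f p) = corner_dist h p"
  using f unfolding box_symmetry_def by blast+

lemma shell_symmetry: "shell h (f c) = f ` shell h c"
proof (intro equalityI subsetI)
  fix r assume "r \<in> shell h (f c)"
  then have "f r \<in> shell h c"
    using l1_symmetry[of c "f r"] in_box_symmetry[of r] by (simp add: shell_def involution)
  then show "r \<in> f ` shell h c"
    by (metis imageI involution)
next
  fix r assume "r \<in> f ` shell h c"
  moreover have "f ` shell h c \<subseteq> shell h (f c)"
    by (simp add: image_subset_iff shell_def l1_symmetry in_box_symmetry)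
  ultimately show "r \<in> shell h (f c)" by blast
qed

lemma spread_symmetry: "spread h (f c) (f ` D) = f ` spread h c D"
  by (force simp: spread_def shell_symmetry l1_symmetry)

lemma few_clean_symmetry: "few_clean h (f c) (f ` D) \<longleftrightarrow> few_clean h c D"
proof -
  have inj: "inj f" by (metis injI involution)
  then have "shell h (f c) - f ` D = f ` (shell h c - D)"
    by (simp add: shell_symmetry image_set_diff)
  moreover have "card (f ` (shell h c - D)) = card (shell h c - D)"
    using inj by (intro card_image) (auto intro: inj_on_subset)
  ultimately show ?thesis
    by (simp add: few_clean_def corner_dist_symmetry)
qed

lemma preserves_few_clean_symmetry:
  assumes "preserves_few_clean h (f c) (f c')"
  shows "preserves_few_clean h c c'"
  using assms unfolding preserves_few_clean_def
  by (metis few_clean_symmetry spread_symmetry)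

end

lemma preserves_few_clean_vertical:
  assumes "(a, b) \<in> box h" "(a', b) \<in> box h" "\<bar>a - a'\<bar> = 1"
  shows "preserves_few_clean h (a, b) (a', b)"
proof -
  \<comment> \<open>Only the starting row must lie in the quadrant, so crossing the middle is
    included.\<close>
  have 1: "preserves_few_clean h (a, b) (a', b)"
    if quadrant: "0 \<le> b" "b < h" "0 \<le> a" "a < h" "0 \<le> a'" "\<bar>a - a'\<bar> = 1" for a a' b
  proof -
    consider "a' = a - 1" | "a' = a + 1" "a + 1 < h" | "a = h - 1" "a' = h"
      using quadrant by linarith
    then show ?thesis
      by cases (use quadrant few_clean_up few_clean_down few_clean_cross in
        \<open>auto simp: preserves_few_clean_def\<close>)
  qed
  have 2: "preserves_few_clean h (a, b) (a', b)"
    if "0 \<le> b" "b < h" "a \<in> {0..2*h-1}" "a' \<in> {0..2*h-1}" "\<bar>a - a'\<bar> = 1" for a a' b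
  proof (cases "a < h")
    case True
    then show ?thesis by (intro 1) (use that in auto)
  next
    case False
    then have "preserves_few_clean h (2 * h - 1 - a, b) (2 * h - 1 - a', b)"
      by (intro 1) (use that in auto)
    then show ?thesis
      using preserves_few_clean_symmetry[OF box_symmetry_flips(1), of h "(a, b)" "(a', b)"]
      by simp
  qed
  show ?thesis
  proof (cases "b < h")
    case True
    then show ?thesis by (intro 2) (use assms in \<open>auto simp: box_def\<close>)
  next
    case False
    then have "preserves_few_clean h (a, 2 * h - 1 - b) (a', 2 * h - 1 - b)"
      by (intro 2) (use assms in \<open>auto simp: box_def\<close>)
    then show ?thesis
      using preserves_few_clean_symmetry[OF box_symmetry_flips(2), of h "(a, b)" "(a', b)"]
      by simp
  qed
qed

lemma preserves_few_clean_step: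
  assumes "c \<in> box h" "c' \<in> box h" "l1_dist c c' \<le> 1"
  shows "preserves_few_clean h c c'"
proof -
  obtain a b a' b' where [simp]: "c = (a, b)" "c' = (a', b')" by force
  consider "c = c'" | "b = b'" "\<bar>a - a'\<bar> = 1" | "a = a'" "\<bar>b - b'\<bar> = 1"
    using assms(3) by (simp add: l1_dist_def) linarith
  then show ?thesis
  proof cases
    case 1
    \<comment> \<open>If the cop stays, the robber may stay too, so no vertex becomes clean.\<close>
    have "card (shell h c - spread h c D) \<le> card (shell h c - D)" for D
      by (rule card_mono) (force simp: spread_def l1_dist_def)+
    then show ?thesis unfolding preserves_few_clean_def few_clean_def 1[symmetric]
      by (meson of_nat_mono order_trans)
  next
    case 2
    then show ?thesis using assms preserves_few_clean_vertical by auto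
  next
    case 3
    have "preserves_few_clean h (b, a) (b', a)"
      by (rule preserves_few_clean_vertical) (use 3 assms in \<open>auto simp: box_def\<close>)
    then show ?thesis
      using 3 preserves_few_clean_symmetry[OF box_symmetry_flips(3), of h c c'] by simp
  qed
qed

text \<open>Up to symmetry, the right arc alone has \<open>a + h + 1 > a + b\<close> vertices. Hence
  the invariant always leaves the robber a position.\<close>

lemma not_few_clean_empty:
  assumes "c \<in> box h"
  shows "\<not> few_clean h c {}"
proof -
  have 1: "\<not> few_clean h (a, b) {}" if "0 \<le> b" "b < h" "0 \<le> a" "a < h" for a b
  proof -
    have "card {0..a + h} \<le> card (right_clean h a b {})"
      by (rule card_mono[OF finite_clean(1)]) (use that in \<open>auto simp: right_clean_def\<close>)
    then show ?thesis
      using that by (simp add: few_clean_def card_clean[where D = "{}", simplified] corner_dist_def)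
  qed
  have 2: "\<not> few_clean h (a, b) {}" if "0 \<le> b" "b < h" "a \<in> {0..2*h-1}" for a b
  proof (cases "a < h")
    case False
    then have "\<not> few_clean h (2 * h - 1 - a, b) {}" using that by (intro 1) auto
    then show ?thesis
      using few_clean_symmetry[OF box_symmetry_flips(1), of h "(a, b)" "{}"] by auto
  qed (use 1 that in auto)
  obtain a b where [simp]: "c = (a, b)" by force
  show ?thesis
  proof (cases "b < h")
    case False
    then have "\<not> few_clean h (a, 2 * h - 1 - b) {}" using assms by (intro 2) (auto simp: box_def)
    then show ?thesis
      using few_clean_symmetry[OF box_symmetry_flips(2), of h "(a, b)" "{}"] by auto
  qed (use 2 assms in \<open>auto simp: box_def\<close>)
qed

section \<open>The evading robber\<close>

text \<open>Koenig's lemma for finite levels: following predecessors back from a far level gives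
  arbitrarily long paths from level 0, and finiteness lets one choose, level by level, a vertex that
  starts paths of every length (\<open>ext\<close>).\<close>

lemma infinite_path:
  fixes D :: "nat \<Rightarrow> 'a set"
  assumes fin: "\<And>t. finite (D t)" and ne: "\<And>t. D t \<noteq> {}"
    and pred: "\<And>t y. y \<in> D (Suc t) \<Longrightarrow> \<exists>x\<in>D t. E x y"
  shows "\<exists>f. \<forall>t. f t \<in> D t \<and> E (f t) (f (Suc t))"
proof -
  define path where "path t T p \<longleftrightarrow>
    (\<forall>s\<le>T. p s \<in> D (t + s)) \<and> (\<forall>s<T. E (p s) (p (Suc s)))" for t T :: nat and p
  define ext where "ext t x \<longleftrightarrow> (\<forall>T. \<exists>p. p 0 = x \<and> path t T p)" for t x
  have compact: "\<exists>x\<in>D t. R x \<and> ext t x"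
    if ex: "\<And>T. \<exists>p. R (p 0) \<and> path t T p" for t and R :: "'a \<Rightarrow> bool"
  proof (rule ccontr)
    assume "\<not> ?thesis"
    then have "\<forall>x\<in>D t. \<exists>T. R x \<longrightarrow> (\<forall>p. p 0 = x \<longrightarrow> \<not> path t T p)"
      unfolding ext_def by blast
    \<comment> \<open>\<open>b x\<close> is a length that no path from \<open>x\<close> attains; a
      path as long as the largest of these bounds contradicts the one for its own first
      vertex.\<close>
    then obtain b where b: "\<And>x p. x \<in> D t \<Longrightarrow> R x \<Longrightarrow> p 0 = x \<Longrightarrow> \<not> path t (b x) p"
      by (metis (no_types, lifting))
    obtain p where p: "R (p 0)" "path t (Max (b ` D t)) p" using ex by blast
    have "p 0 \<in> D t" using p(2) by (auto simp: path_def)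
    moreover from this have "b (p 0) \<le> Max (b ` D t)" using fin by simp
    then have "path t (b (p 0)) p" using p(2) by (auto simp: path_def)
    ultimately show False using b p(1) by blast
  qed
  have backward: "\<exists>p. p T = y \<and> path 0 T p" if "y \<in> D T" for T y
    using that
  proof (induction T arbitrary: y)
    case 0
    then show ?case by (intro exI[of _ "\<lambda>_. y"]) (auto simp: path_def)
  next
    case (Suc T)
    obtain x where x: "x \<in> D T" "E x y" using pred Suc.prems by blast
    obtain p where p: "p T = x" "path 0 T p" using Suc.IH x(1) by blast
    show ?case
      using p x Suc.prems
      by (intro exI[of _ "p(Suc T := y)"]) (auto simp: path_def le_Suc_eq less_Suc_eq)
  qed
  have "\<exists>p. True \<and> path 0 T p" for T
    using ne[of T] backward by blast
  then have start: "\<exists>x. ext 0 x" using compact[of "\<lambda>_. True" 0] by auto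
  have continue: "\<exists>y. ext (Suc t) y \<and> E x y" if x: "ext t x" for t x
  proof -
    have "\<exists>p. E x (p 0) \<and> path (Suc t) T p" for T
    proof -
      obtain p where "p 0 = x" "path t (Suc T) p" using x by (auto simp: ext_def)
      then show ?thesis by (intro exI[of _ "\<lambda>s. p (Suc s)"]) (auto simp: path_def)
    qed
    then show ?thesis using compact[of "E x" "Suc t"] by auto
  qed
  obtain f where f: "\<And>t. ext t (f t)" "\<And>t. E (f t) (f (Suc t))"
    using dependent_nat_choice[of ext "\<lambda>_. E"] start continue by metis
  have "f t \<in> D t" for t
    using f(1)[of t] by (auto simp: ext_def path_def dest!: spec[of _ 0])
  then show ?thesis using f by auto
qed

lemma evading_walk:
  assumes c: "\<And>t. c t \<in> box h" "\<And>t. l1_dist (c t) (c (Suc t)) \<le> 1"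
  shows "\<exists>r. \<forall>t. r t \<in> shell h (c t) \<and> l1_dist (r t) (r (Suc t)) \<le> 1"
proof -
  \<comment> \<open>\<open>D t\<close> collects the possible positions at time \<open>t\<close>. At
    time 0 it is the whole shell, so nothing is clean.\<close>
  define D where "D = rec_nat (shell h (c 0)) (\<lambda>t. spread h (c (Suc t)))"
  have D0: "D 0 = shell h (c 0)" and DS: "\<And>t. D (Suc t) = spread h (c (Suc t)) (D t)"
    by (simp_all add: D_def)
  have sub: "D t \<subseteq> shell h (c t)" for t
    by (cases t) (auto simp: D0 DS spread_def)
  have few: "few_clean h (c t) (D t)" for t
  proof (induction t)
    case 0
    have "0 \<le> corner_dist h (c 0)" using c(1)[of 0] by (auto simp: corner_dist_def box_def)
    then show ?case by (simp add: few_clean_def D0)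
  next
    case (Suc t)
    then show ?case
      using preserves_few_clean_step[OF c(1) c(1) c(2)] by (simp add: DS preserves_few_clean_def)
  qed
  have "\<exists>r. \<forall>t. r t \<in> D t \<and> l1_dist (r t) (r (Suc t)) \<le> 1"
  proof (rule infinite_path)
    show "finite (D t)" for t using sub finite_shell finite_subset by blast
    show "D t \<noteq> {}" for t using few not_few_clean_empty c(1) by metis
    show "\<exists>x\<in>D t. l1_dist x y \<le> 1" if "y \<in> D (Suc t)" for t y
      using that by (auto simp: DS spread_def)
  qed
  then show ?thesis using sub by blast
qed

section \<open>Distances in the grid\<close>

definition grid :: "nat \<Rightarrow> nat \<Rightarrow> (nat \<times> nat, (nat \<times> nat) \<times> nat \<times> nat) pre_digraph" where
  "grid n m = with_proj (path_graph n \<box> path_graph m)"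

definition coords :: "nat \<times> nat \<Rightarrow> int \<times> int" where
  "coords u = (int (fst u), int (snd u))"

lemma verts_grid: "verts (grid n m) = {1..n} \<times> {1..m}"
  by (simp add: grid_def cart_prod_def path_graph_def)

lemma tail_head_grid [simp]: "tail (grid n m) = fst" "head (grid n m) = snd"
  by (simp_all add: grid_def)

lemma arcs_grid:
  "(u, v) \<in> arcs (grid n m) \<longleftrightarrow>
     u \<in> verts (grid n m) \<and> v \<in> verts (grid n m) \<and> l1_dist (coords u) (coords v) = 1"
  by (cases u; cases v)
    (auto simp: grid_def cart_prod_def path_graph_def l1_dist_def coords_def)

lemma wf_digraph_grid: "wf_digraph (grid n m)"
proof -
  interpret pair_graph "path_graph n \<box> path_graph m"
    by (intro pair_graph_cart_prod pair_graph_path_graph)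
  show ?thesis unfolding grid_def by unfold_locales
qed

lemma l1_triangle: "l1_dist p r \<le> l1_dist p q + l1_dist q r"
  by (simp add: l1_dist_def)

lemma awalk_grid_length:
  assumes "pre_digraph.awalk (grid n m) u p v"
  shows "l1_dist (coords u) (coords v) \<le> int (length p)"
proof -
  interpret wf_digraph "grid n m" by (rule wf_digraph_grid)
  show ?thesis using assms
  proof (induction p arbitrary: u)
    case Nil
    then show ?case by (simp add: awalk_Nil_iff l1_dist_def)
  next
    case (Cons e p)
    obtain w where e: "e = (u, w)" "(u, w) \<in> arcs (grid n m)" "awalk w p v"
      using Cons.prems by (cases e) (auto simp: awalk_Cons_iff)
    then have "l1_dist (coords u) (coords w) = 1" by (simp only: arcs_grid)
    then show ?case
      using Cons.IH[OF e(3)] l1_triangle[of "coords u" "coords v" "coords w"] by simp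
  qed
qed

lemma ex_awalk_grid:
  assumes "u \<in> verts (grid n m)" "v \<in> verts (grid n m)"
  shows "\<exists>p. pre_digraph.awalk (grid n m) u p v \<and> int (length p) = l1_dist (coords u) (coords v)"
proof -
  interpret wf_digraph "grid n m" by (rule wf_digraph_grid)
  have "\<exists>p. awalk u p v \<and> length p = k"
    if "u \<in> verts (grid n m)" "l1_dist (coords u) (coords v) = int k" for k u
    using that
  proof (induction k arbitrary: u)
    case 0
    then have "u = v" by (cases u; cases v) (auto simp: l1_dist_def coords_def)
    then show ?case using 0 by (intro exI[of _ "[]"]) (simp add: awalk_Nil_iff)
  next
    case (Suc k)
    obtain i j i' j' where uv [simp]: "u = (i, j)" "v = (i', j')" by force
    \<comment> \<open>Correct the first coordinate, then the second; moving towards \<open>v\<close>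
      never leaves the grid.\<close>
    define w where "w = (if i < i' then (i + 1, j) else if i' < i then (i - 1, j)
      else if j < j' then (i, j + 1) else (i, j - 1))"
    have w: "w \<in> verts (grid n m)" "l1_dist (coords u) (coords w) = 1" "l1_dist (coords w) (coords v) = int k"
      using Suc.prems assms(2)
      by (auto simp: w_def l1_dist_def coords_def verts_grid split: if_splits)
    obtain p where p: "awalk w p v" "length p = k" using Suc.IH w by blast
    have "(u, w) \<in> arcs (grid n m)" using w Suc.prems by (simp only: arcs_grid)
    then have "awalk u ((u, w) # p) v" using p(1) by (simp add: awalk_Cons_iff)
    then show ?case using p(2) by (intro exI[of _ "(u, w) # p"]) simp
  qed
  from this[OF assms(1), of "nat (l1_dist (coords u) (coords v))"] show ?thesis
    by (auto simp: l1_dist_def)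
qed

lemma gdist_grid:
  assumes "u \<in> verts (grid n m)" "v \<in> verts (grid n m)"
  shows "gdist (grid n m) u v = ereal (real_of_int (l1_dist (coords u) (coords v)))"
proof -
  interpret wf_digraph "grid n m" by (rule wf_digraph_grid)
  have cost: "awalk_cost (\<lambda>_. 1) p = real (length p)" for p
    by (induction p) auto
  show ?thesis unfolding gdist_def
  proof (rule antisym)
    obtain p where p: "awalk u p v" "int (length p) = l1_dist (coords u) (coords v)"
      using ex_awalk_grid[OF assms] by blast
    then show "\<mu> (\<lambda>_. 1) u v \<le> ereal (real_of_int (l1_dist (coords u) (coords v)))"
      using min_cost_le_walk_cost[OF p(1), of "\<lambda>_. 1"] by (simp add: cost flip: p(2))
    show "ereal (real_of_int (l1_dist (coords u) (coords v))) \<le> \<mu> (\<lambda>_. 1) u v"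
      unfolding \<mu>_def
    proof (rule INF_greatest)
      fix p assume "p \<in> {p. awalk u p v}"
      then have "l1_dist (coords u) (coords v) \<le> int (length p)" using awalk_grid_length by blast
      then show "ereal (real_of_int (l1_dist (coords u) (coords v))) \<le> ereal (awalk_cost (\<lambda>_. 1) p)"
        by (simp add: cost)
    qed
  qed
qed

lemma lazy_walk_grid:
  "lazy_walk (grid n m) w \<longleftrightarrow>
     (\<forall>t. w t \<in> verts (grid n m) \<and> l1_dist (coords (w t)) (coords (w (Suc t))) \<le> 1)"
proof -
  have dom: "u \<rightarrow>\<^bsub>grid n m\<^esub> v \<longleftrightarrow> (u, v) \<in> arcs (grid n m)" for u v
    by (simp add: grid_def)
  have eq: "l1_dist (coords u) (coords v) \<le> 1 \<longleftrightarrow> v = u \<or> l1_dist (coords u) (coords v) = 1" for u v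
    by (simp add: l1_dist_def coords_def prod_eq_iff) linarith
  have step: "v = u \<or> u \<rightarrow>\<^bsub>grid n m\<^esub> v \<longleftrightarrow> l1_dist (coords u) (coords v) \<le> 1"
    if "u \<in> verts (grid n m)" "v \<in> verts (grid n m)" for u v
    using that unfolding dom arcs_grid eq by simp
  show ?thesis unfolding lazy_walk_def using step by metis
qed

lemma captures_grid:
  assumes "lazy_walk (grid n m) c" "lazy_walk (grid n m) r"
  shows "captures (grid n m) \<rho> c r \<longleftrightarrow>
    (\<exists>t. l1_dist (coords (c t)) (coords (r t)) \<le> int \<rho> \<or> l1_dist (coords (c (Suc t))) (coords (r t)) \<le> int \<rho>)"
proof -
  have "gdist (grid n m) (c s) (r t) \<le> ereal (real \<rho>) \<longleftrightarrow> l1_dist (coords (c s)) (coords (r t)) \<le> int \<rho>"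
    for s t
    using assms by (subst gdist_grid) (auto simp: lazy_walk_grid)
  then show ?thesis by (simp add: captures_def)
qed

section \<open>The two bounds\<close>

text \<open>The sweep starts in column 1, so the robber has to stay strictly to the right of the
  cop. Capture is tested after each single move, so the two cannot swap columns, and in column
  \<open>m\<close> the robber runs out of space.\<close>

lemma winning_patrol_middle_row:
  assumes "0 < n" "0 < m"
  shows "winning_patrol (grid n m) (n div 2) (\<lambda>t. ((n + 1) div 2, min (Suc t) m))"
    (is "winning_patrol _ _ ?c")
  unfolding winning_patrol_def
proof (intro conjI allI impI)
  show c: "lazy_walk (grid n m) ?c"
    using assms by (auto simp: lazy_walk_grid verts_grid l1_dist_def coords_def)
  fix r assume r: "lazy_walk (grid n m) r"
  then have r_in: "1 \<le> fst (r t)" "fst (r t) \<le> n" "1 \<le> snd (r t)" "snd (r t) \<le> m"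
    and r_step: "snd (r t) \<le> Suc (snd (r (Suc t)))" for t
  proof -
    have "r t \<in> {1..n} \<times> {1..m}" "l1_dist (coords (r t)) (coords (r (Suc t))) \<le> 1"
      using r by (auto simp: lazy_walk_grid verts_grid)
    then show "1 \<le> fst (r t)" "fst (r t) \<le> n" "1 \<le> snd (r t)" "snd (r t) \<le> m"
      "snd (r t) \<le> Suc (snd (r (Suc t)))"
      by (auto simp: l1_dist_def coords_def)
  qed
  show "captures (grid n m) (n div 2) ?c r"
  proof (rule ccontr)
    assume free: "\<not> captures (grid n m) (n div 2) ?c r"
    \<comment> \<open>Row \<open>(n + 1) div 2\<close> is within \<open>n div 2\<close> of both row
      1 and row \<open>n\<close>, for either parity of \<open>n\<close>.\<close>
    have cover: "l1_dist (coords ((n + 1) div 2, snd (r t))) (coords (r t)) \<le> int (n div 2)" for t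
      using r_in[of t] by (auto simp: l1_dist_def coords_def)
    have avoid: "min (Suc t) m \<noteq> snd (r t)" "min (Suc (Suc t)) m \<noteq> snd (r t)" for t
      using free cover[of t] unfolding captures_grid[OF c r] by metis+
    have "min (Suc t) m < snd (r t)" for t
    proof (induction t)
      case 0
      then show ?case using avoid(1)[of 0] r_in[of 0] assms by auto
    next
      case (Suc t)
      then show ?case
        using avoid(1)[of "Suc t"] avoid(2)[of t] r_step[of t] by linarith
    qed
    from this[of m] show False using r_in[of m] by simp
  qed
qed

lemma winning_patrol_grid_bound:
  assumes "n \<le> m" "winning_patrol (grid n m) \<rho> c"
  shows "n \<le> 2 * \<rho> + 3"
proof (rule ccontr)
  assume large: "\<not> n \<le> 2 * \<rho> + 3"
  \<comment> \<open>Now \<open>2 * h \<le> n \<le> m\<close>, so the square fits into the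
    grid.\<close>
  define h where "h = int \<rho> + 2"
  \<comment> \<open>Clamping to the corner square, shifted to start at 0. Clamping does not increase
    distances, so the projected cop makes legal moves and the true cop is no closer to a robber in
    the square.\<close>
  define proj where "proj u = (min (fst u) (2 * h) - 1, min (snd u) (2 * h) - 1)" for u :: "int \<times> int"
  have c: "lazy_walk (grid n m) c" using assms by (simp add: winning_patrol_def)
  have "\<exists>s. \<forall>t. s t \<in> shell h (proj (coords (c t))) \<and> l1_dist (s t) (s (Suc t)) \<le> 1"
  proof (rule evading_walk)
    show "proj (coords (c t)) \<in> box h" for t
    proof -
      have "c t \<in> {1..n} \<times> {1..m}" using c by (simp add: lazy_walk_grid verts_grid)
      then show ?thesis by (auto simp: proj_def box_def coords_def h_def)
    qed
    show "l1_dist (proj (coords (c t))) (proj (coords (c (Suc t)))) \<le> 1" for t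
    proof -
      have "l1_dist (coords (c t)) (coords (c (Suc t))) \<le> 1"
        using c by (simp add: lazy_walk_grid)
      then show ?thesis by (auto simp: proj_def l1_dist_def)
    qed
  qed
  then obtain s where s: "\<And>t. s t \<in> shell h (proj (coords (c t)))" "\<And>t. l1_dist (s t) (s (Suc t)) \<le> 1"
    by blast
  define r where "r t = (nat (fst (s t) + 1), nat (snd (s t) + 1))" for t
  have s_box: "0 \<le> fst (s t)" "fst (s t) < 2 * h" "0 \<le> snd (s t)" "snd (s t) < 2 * h" for t
    using s(1)[of t] by (auto simp: shell_def box_def)
  have coords_r: "coords (r t) = (fst (s t) + 1, snd (s t) + 1)" for t
    using s_box[of t] by (simp add: r_def coords_def)
  have "r t \<in> {1..n} \<times> {1..m}" for t
    using s_box[of t] large assms(1) by (auto simp: r_def h_def)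
  moreover have "l1_dist (coords (r t)) (coords (r (Suc t))) \<le> 1" for t
    using s(2)[of t] by (simp add: coords_r l1_dist_def)
  ultimately have r: "lazy_walk (grid n m) r"
    by (simp add: lazy_walk_grid verts_grid)
  have far: "l1_dist (coords (c t)) (coords (r t)) \<ge> h" for t
  proof -
    have "l1_dist (proj (coords (c t))) (s t) = h" using s(1)[of t] by (simp add: shell_def)
    then show ?thesis using s_box[of t] by (auto simp: coords_r proj_def l1_dist_def)
  qed
  have "captures (grid n m) \<rho> c r" using assms(2) r by (simp add: winning_patrol_def)
  then obtain t where "l1_dist (coords (c t)) (coords (r t)) \<le> int \<rho> \<or>
      l1_dist (coords (c (Suc t))) (coords (r t)) \<le> int \<rho>"
    unfolding captures_grid[OF c r] by blast
  moreover have "l1_dist (coords (c t)) (coords (c (Suc t))) \<le> 1"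
    using c by (simp add: lazy_walk_grid)
  \<comment> \<open>After the cop's move the distance is still at least \<open>h - 1\<close>, which
    exceeds the radius by one.\<close>
  ultimately show False
    using far[of t] l1_triangle[of "coords (c t)" "coords (r t)" "coords (c (Suc t))"]
    by (auto simp: h_def)
qed

theorem theorem7:
  fixes n m :: nat
  assumes "0 < n" and "n \<le> m"
  shows "min ((real n - 3) / 2) ((2 * real m + real n - 10) / 8)
           \<le> real (patrol_radius (with_proj (path_graph n \<box> path_graph m)))
       \<and> real (patrol_radius (with_proj (path_graph n \<box> path_graph m))) \<le> real n / 2"
proof -
  let ?\<rho> = "patrol_radius (grid n m)"
  have sweep: "\<exists>c. winning_patrol (grid n m) (n div 2) c"
    using winning_patrol_middle_row[of n m] assms by auto
  \<comment> \<open>The sweep shows that some radius wins, so the least one is attained and the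
    lower bound applies to it.\<close>
  then have "\<exists>c. winning_patrol (grid n m) ?\<rho> c"
    unfolding patrol_radius_def by (rule LeastI)
  then have "n \<le> 2 * ?\<rho> + 3" using winning_patrol_grid_bound assms(2) by blast
  then have "real n \<le> real (2 * ?\<rho> + 3)" by (simp only: of_nat_le_iff)
  then have "(real n - 3) / 2 \<le> real ?\<rho>" by simp
  moreover have "?\<rho> \<le> n div 2" unfolding patrol_radius_def using sweep by (rule Least_le)
  then have "real ?\<rho> \<le> real n / 2" by linarith
  ultimately show ?thesis unfolding grid_def by linarith
qed

end
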